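(* There exist absolute constants $c,C>0$ such that the following holds. Let $p>1$, let $n\ge1$ be an integer, and let $\xi_1,\dots,\xi_n$ be i.i.d. copies of a $\log$-$\gamma_{1,p}$ distributed random variable $\xi$. Then for all $x\in\mathbb{R}^n$ $$c\,\|x\|_{M_\xi}\le\mathbb{E}\max_{1\le i\le n}|x_i\xi_i|\le C\,\|x\|_{M_\xi},$$ and, for $s\ge0$, the function $M_\xi$ is given by $$M_\xi(s)=\begin{cases}\frac{1}{p-1}s^p,& s\le1,\\ \frac{p}{p-1}s-1,& s>1.\end{cases}$$
   Context: For parameters $q,p>0$, a random variable is $\log$-$\gamma_{q,p}$ distributed if it has density $f(x)=\frac{p^q}{\Gamma(q)}x^{-p-1}(\ln x)^{q-1}$ for $x\ge1$ and $f(x)=0$ for $x<1$; in particular the $\log$-$\gamma_{1,p}$ density is $p\,x^{-p-1}$ on $[1,\infty)$. For a random variable $\xi$ with finite first moment, define $$M_\xi(s)=\int_0^s\left(\frac1t\,\mathbb{P}\Big(|\xi|\ge\frac1t\Big)+\int_{1/t}^\infty\mathbb{P}(|\xi|\ge u)\,du\right)dt,\qquad s\ge0.$$ A convex function $M:[0,\infty)\to[0,\infty)$ with $M(0)=0$ is called an Orlicz function; the associated Orlicz norm on $\mathbb{R}^n$ is $\|x\|_M=\inf\{t>0:\sum_{i=1}^nM(|x_i|/t)\le1\}$. *)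

theory Defs
  imports "HOL-Probability.Probability"
begin

text \<open>Since \<open>0 powr 0 = 0\<close>, for \<open>q = 1\<close> the value at \<open>x = 1\<close> is \<open>0\<close> rather than \<open>p\<close>. This is a
  Lebesgue null set, so the distribution is unaffected.\<close>

definition log_gamma_density :: "real \<Rightarrow> real \<Rightarrow> real \<Rightarrow> real" where
  "log_gamma_density q p x =
     (if x \<ge> 1 then p powr q / Gamma q * x powr (- p - 1) * (ln x) powr (q - 1) else 0)"

lemma log_gamma_density_1:
  assumes "p > 0" "x > 1"
  shows "log_gamma_density 1 p x = p * x powr (- p - 1)"
  using assms by (simp add: log_gamma_density_def)

text \<open>The function \<open>M\<^sub>\<xi>\<close> of a random variable \<open>X\<close> on \<open>N\<close>. When \<open>X\<close> has a finite first moment, both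
  integrands are integrable, so the integrals have their usual meaning.\<close>

definition orlicz_fun_of :: "'a measure \<Rightarrow> ('a \<Rightarrow> real) \<Rightarrow> real \<Rightarrow> real" where
  "orlicz_fun_of N X s =
     (LBINT t:{0<..s}. 1 / t * measure N {\<omega> \<in> space N. \<bar>X \<omega>\<bar> \<ge> 1 / t}
                      + (LBINT u:{1 / t..}. measure N {\<omega> \<in> space N. \<bar>X \<omega>\<bar> \<ge> u}))"

text \<open>Vectors in \<open>\<real>\<^sup>n\<close> are functions on \<open>nat\<close>, of which only the values on \<open>{1..n}\<close> matter.\<close>

definition orlicz_norm :: "(real \<Rightarrow> real) \<Rightarrow> nat \<Rightarrow> (nat \<Rightarrow> real) \<Rightarrow> real" where
  "orlicz_norm F n x = Inf {t. t > 0 \<and> (\<Sum>i = 1..n. F (\<bar>x i\<bar> / t)) \<le> 1}"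

text \<open>The copies may live on a different probability space than \<open>X\<close> itself.\<close>

definition iid_copies ::
    "'a measure \<Rightarrow> nat \<Rightarrow> (nat \<Rightarrow> 'a \<Rightarrow> real) \<Rightarrow> 'b measure \<Rightarrow> ('b \<Rightarrow> real) \<Rightarrow> bool" where
  "iid_copies M n \<xi> N X \<longleftrightarrow>
     prob_space.indep_vars M (\<lambda>_. borel) \<xi> {1..n} \<and>
     (\<forall>i\<in>{1..n}. distr M borel (\<xi> i) = distr N borel X)"

text \<open>The constants \<open>c\<close>, \<open>C\<close> satisfy the two-sided estimate for all random variables on probability
  spaces over the type \<open>'a\<close>. The type argument makes it possible to say that the
  constants do not depend on the type of the sample space.\<close>

definition max_comparison :: "'a itself \<Rightarrow> real \<Rightarrow> real \<Rightarrow> bool" where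
  "max_comparison _ c C \<longleftrightarrow>
     (\<forall>(p::real) (n::nat) (N::'a measure) X (M::'a measure) \<xi> (x::nat \<Rightarrow> real).
        p > 1 \<longrightarrow> n \<ge> 1 \<longrightarrow> prob_space N \<longrightarrow> distributed N lborel X (log_gamma_density 1 p) \<longrightarrow>
        prob_space M \<longrightarrow> iid_copies M n \<xi> N X \<longrightarrow>
          c * orlicz_norm (orlicz_fun_of N X) n x
            \<le> prob_space.expectation M (\<lambda>\<omega>. Max ((\<lambda>i. \<bar>x i * \<xi> i \<omega>\<bar>) ` {1..n}))
        \<and> prob_space.expectation M (\<lambda>\<omega>. Max ((\<lambda>i. \<bar>x i * \<xi> i \<omega>\<bar>) ` {1..n}))
            \<le> C * orlicz_norm (orlicz_fun_of N X) n x)"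

end

theory Submission
  imports Defs
begin

text \<open>The case \<open>q = 1\<close> of the log-gamma distribution is the Pareto distribution, with tail
  \<open>u powr (- p)\<close> for \<open>u \<ge> 1\<close>. Its Orlicz function is the mean excess
  \<open>M(s) = E (max 0 (s \<bar>X\<bar> - 1))\<close>, equivalently \<open>E (max 0 (a \<bar>X\<bar> - t)) = t M(a / t)\<close> for \<open>a \<ge> 0\<close> and
  \<open>t > 0\<close>; here both sides are computed explicitly
  (\<open>orlicz_fun_of_pareto\<close>, \<open>pareto_excess\<close>). With this identity the norm of a nonzero \<open>x\<close> is the
  threshold at which the variables \<open>Y i = \<bar>x i * \<xi> i\<bar>\<close> have total mean excess \<open>\<Sum>i. E (max 0 (Y i - t))\<close> equal
  to \<open>t\<close> itself, and the two estimates compare the expected maximum with that threshold.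

  For the upper estimate, \<open>max Y \<le> t + (\<Sum>i. max 0 (Y i - t))\<close> holds pointwise
  (\<open>expectation_Max_le\<close>), so every \<open>t\<close> with total excess at most \<open>t\<close> satisfies
  \<open>E (max Y) \<le> 2 t\<close>.

  For the lower estimate, keep of each excess only the part where no other variable reaches \<open>t\<close>.
  At most one of these parts is nonzero at a time, so pointwise
  \<open>max Y \<ge> t 1{max Y \<ge> t} + (\<Sum>i. max 0 (Y i - t) * (\<Prod>j\<noteq>i. 1{Y j < t}))\<close> (\<open>Max_ge_excess\<close>). Put
  \<open>Q = P(max Y < t)\<close>. By independence the expectation of the right-hand side is at least
  \<open>t (1 - Q) + Q (\<Sum>i. E (max 0 (Y i - t)))\<close>, and if the total excess is at least \<open>t\<close> this is at least
  \<open>t\<close> (\<open>expectation_Max_ge\<close>). Neither estimate loses a factor depending on \<open>p\<close> or \<open>n\<close>, so the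
  constants \<open>c = 1\<close> and \<open>C = 2\<close> are absolute.

  Constants valid for sample spaces over \<open>nat \<Rightarrow> real\<close> are valid over every type, because both
  sides of the estimate depend only on the joint distribution of the copies, which is itself a
  probability measure on \<open>nat \<Rightarrow> real\<close> (\<open>max_comparison_transfer\<close>).\<close>

section \<open>The Pareto distribution\<close>

lemma has_bochner_integral_lborel_of_has_integral:
  fixes f :: "real \<Rightarrow> real"
  assumes [measurable]: "f \<in> borel_measurable borel" "A \<in> sets borel"
    and nonneg: "\<And>x. x \<in> A \<Longrightarrow> 0 \<le> f x" and I: "(f has_integral r) A"
  shows "has_bochner_integral lborel (\<lambda>x. indicator A x * f x) r"
proof -
  have r: "r \<ge> 0" using has_integral_nonneg[OF I] nonneg by auto
  have eq: "(\<lambda>x. indicator A x * f x) = (\<lambda>x. if x \<in> A then f x else 0)"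
    by (auto simp: fun_eq_iff)
  have "((\<lambda>x. indicator A x * f x) has_integral r) UNIV"
    using I by (simp add: eq has_integral_restrict_UNIV)
  then have "(\<integral>\<^sup>+x. ennreal (indicator A x * f x) \<partial>lborel) = ennreal r"
    by (intro nn_integral_has_integral_lborel) (auto simp: nonneg split: split_indicator)
  then show ?thesis
    using r nonneg by (intro has_bochner_integral_nn_integral) (auto split: split_indicator)
qed

lemma has_bochner_integral_powr_tail:
  fixes b e :: real
  assumes "b > 0" "e < -1"
  shows "has_bochner_integral lborel (\<lambda>x. indicator {b..} x * x powr e) (b powr (e + 1) / (- e - 1))"
proof -
  have "- (b powr (e + 1)) / (e + 1) = b powr (e + 1) / (- e - 1)"
    using assms by (simp add: divide_simps algebra_simps)
  with has_integral_powr_to_inf[OF assms(2,1)] show ?thesis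
    by (intro has_bochner_integral_lborel_of_has_integral) auto
qed

text \<open>One family of truncated means serves two purposes: \<open>\<alpha> = 0\<close>, \<open>\<beta> = -1\<close> gives the tail, and
  the choice of \<open>b\<close> as the point where \<open>\<alpha> * x - \<beta>\<close> becomes positive (or \<open>b = 1\<close>) gives the mean
  excess.\<close>

lemma pareto_partial_mean:
  fixes p :: real
  assumes p: "p > 1" and D: "distributed N lborel X (log_gamma_density 1 p)" and b: "b \<ge> 1"
  shows "has_bochner_integral N (\<lambda>\<omega>. indicator {b..} (X \<omega>) * (\<alpha> * X \<omega> - \<beta>))
           (\<alpha> * p / (p - 1) * b powr (1 - p) - \<beta> * b powr (- p))"
proof -
  let ?g = "\<lambda>x. indicator {b..} x * (\<alpha> * x - \<beta>) :: real"
  have nn: "0 \<le> log_gamma_density 1 p x" for x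
    using p by (simp add: log_gamma_density_def)
  have [measurable]: "log_gamma_density 1 p \<in> borel_measurable borel"
    unfolding log_gamma_density_def by measurable
  have "has_bochner_integral lborel
          (\<lambda>x. \<alpha> * p * (indicator {b..} x * x powr (- p)) - \<beta> * p * (indicator {b..} x * x powr (- p - 1)))
          (\<alpha> * p * (b powr (- p + 1) / (- (- p) - 1)) - \<beta> * p * (b powr (- p - 1 + 1) / (- (- p - 1) - 1)))"
    using p b
    by (intro has_bochner_integral_diff has_bochner_integral_mult_right has_bochner_integral_powr_tail) auto
  also have "\<alpha> * p * (b powr (- p + 1) / (- (- p) - 1)) - \<beta> * p * (b powr (- p - 1 + 1) / (- (- p - 1) - 1))
      = \<alpha> * p / (p - 1) * b powr (1 - p) - \<beta> * b powr (- p)"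
    using p by simp
  also have "has_bochner_integral lborel
          (\<lambda>x. \<alpha> * p * (indicator {b..} x * x powr (- p)) - \<beta> * p * (indicator {b..} x * x powr (- p - 1))) =
        has_bochner_integral lborel (\<lambda>x. log_gamma_density 1 p x * ?g x)"
  proof (intro ext has_bochner_integral_cong_AE)
    \<comment> \<open>The given density vanishes at \<open>1\<close>, so the two integrands may differ there.\<close>
    show "AE x in lborel. \<alpha> * p * (indicator {b..} x * x powr (- p)) - \<beta> * p * (indicator {b..} x * x powr (- p - 1))
        = log_gamma_density 1 p x * ?g x"
      using AE_lborel_singleton[of 1]
    proof eventually_elim
      case (elim x)
      show ?case
      proof (cases "x \<ge> b")
        case True
        then have x: "x > 1" using elim b by auto
        have "x powr (- p) = x powr (- p - 1) * x powr 1" by (subst powr_add[symmetric]) simp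
        with x True p show ?thesis by (simp add: log_gamma_density_1 algebra_simps)
      qed auto
    qed
  qed auto
  finally have *: "has_bochner_integral lborel (\<lambda>x. log_gamma_density 1 p x * ?g x)
     (\<alpha> * p / (p - 1) * b powr (1 - p) - \<beta> * b powr (- p))" .
  have [measurable]: "?g \<in> borel_measurable lborel" by measurable
  show ?thesis
    using * distributed_integrable[OF D, of ?g] distributed_integral[OF D, of ?g] nn
    by (auto simp: has_bochner_integral_iff)
qed

lemma pareto_AE_ge_1:
  assumes "p > 1" "prob_space N" and D: "distributed N lborel X (log_gamma_density 1 p)"
  shows "AE \<omega> in N. X \<omega> \<ge> 1"
proof -
  interpret prob_space N by fact
  have [measurable]: "X \<in> borel_measurable N" using distributed_measurable[OF D] by simp
  have "has_bochner_integral N (\<lambda>\<omega>. indicator {1..} (X \<omega>)) (1::real)"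
    using pareto_partial_mean[OF assms(1) D, of 1 0 "-1"] by simp
  moreover have "(\<lambda>\<omega>. indicator {1..} (X \<omega>) :: real) \<in> borel_measurable N" by simp
  moreover have "(\<integral>\<omega>. indicator {1..} (X \<omega>) \<partial>N) = prob {\<omega> \<in> space N. X \<omega> \<ge> 1}"
    by (subst Bochner_Integration.integral_cong[where g="indicator {\<omega> \<in> space N. X \<omega> \<ge> 1}" and N=N])
       (auto simp: indicator_def)
  ultimately have "prob {\<omega> \<in> space N. X \<omega> \<ge> 1} = 1"
    by (simp add: has_bochner_integral_iff)
  then show ?thesis by (subst (asm) prob_Collect_eq_1) auto
qed

lemma pareto_tail:
  assumes p: "p > 1" and N: "prob_space N" and D: "distributed N lborel X (log_gamma_density 1 p)"
  shows "measure N {\<omega> \<in> space N. \<bar>X \<omega>\<bar> \<ge> u} = (if u \<le> 1 then 1 else u powr (- p))"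
proof -
  interpret prob_space N by fact
  have [measurable]: "X \<in> borel_measurable N" using distributed_measurable[OF D] by simp
  note AE = pareto_AE_ge_1[OF assms]
  show ?thesis
  proof (cases "u \<le> 1")
    case True
    have "AE \<omega> in N. \<bar>X \<omega>\<bar> \<ge> u" using AE by eventually_elim (use True in auto)
    with True show ?thesis by (simp add: prob_Collect_eq_1)
  next
    case False
    have "has_bochner_integral N (\<lambda>\<omega>. indicator {u..} (X \<omega>)) (u powr (- p))"
      using pareto_partial_mean[OF p D, of u 0 "-1"] False by simp
    moreover have "(\<integral>\<omega>. indicator {u..} (X \<omega>) \<partial>N) = (\<integral>\<omega>. (indicator {\<omega> \<in> space N. \<bar>X \<omega>\<bar> \<ge> u} \<omega> :: real) \<partial>N)"
    proof (intro integral_cong_AE)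
      show "AE \<omega> in N. indicator {u..} (X \<omega>) = (indicator {\<omega> \<in> space N. \<bar>X \<omega>\<bar> \<ge> u} \<omega> :: real)"
        using AE AE_space by eventually_elim (auto simp: indicator_def)
    qed auto
    ultimately show ?thesis using False by (simp add: has_bochner_integral_iff)
  qed
qed

definition pareto_orlicz :: "real \<Rightarrow> real \<Rightarrow> real" where
  "pareto_orlicz p s = (if s \<le> 1 then 1 / (p - 1) * s powr p else p / (p - 1) * s - 1)"

text \<open>The identity \<open>E (max 0 (a \<bar>X\<bar> - t)) = t M(a / t)\<close> translates statements about the Orlicz norm
  into statements about expected excesses over the level \<open>t\<close>.\<close>

lemma pareto_excess:
  fixes p a t :: real
  assumes p: "p > 1" and N: "prob_space N" and D: "distributed N lborel X (log_gamma_density 1 p)"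
    and t: "t > 0" and a: "a \<ge> 0"
  shows "has_bochner_integral N (\<lambda>\<omega>. max 0 (\<bar>a * X \<omega>\<bar> - t)) (t * pareto_orlicz p (a / t))"
proof (cases "a = 0")
  case True
  then show ?thesis using t p by (simp add: pareto_orlicz_def max_def has_bochner_integral_zero)
next
  case False
  with a have a: "a > 0" by simp
  have [measurable]: "X \<in> borel_measurable N" using distributed_measurable[OF D] by simp
  \<comment> \<open>Since \<open>X \<ge> 1\<close> almost surely, the excess is positive exactly when \<open>X\<close> exceeds \<open>b\<close>.\<close>
  define b where "b = max 1 (t / a)"
  have "\<alpha>' = t * pareto_orlicz p (a / t)"
    if "\<alpha>' = a * p / (p - 1) * b powr (1 - p) - t * b powr (- p)" for \<alpha>'
  proof (cases "a \<le> t")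
    case True
    have b: "b = t / a" using True a by (simp add: b_def max_def)
    have "(t / a) powr (1 - p) = (t / a) powr 1 * (t / a) powr (- p)"
      by (subst powr_add[symmetric]) simp
    moreover have "(t / a) powr (- p) = (a / t) powr p"
      using a t by (simp add: powr_minus_divide powr_divide)
    ultimately have "a * (t / a) powr (1 - p) = t * (a / t) powr p"
      using a t by simp
    then have "\<alpha>' = p / (p - 1) * (t * (a / t) powr p) - t * (a / t) powr p"
      using that \<open>(t / a) powr (- p) = (a / t) powr p\<close> unfolding b by (simp add: field_simps)
    also have "\<dots> = t * pareto_orlicz p (a / t)"
      using True t p by (simp add: pareto_orlicz_def divide_simps) (simp add: algebra_simps)
    finally show ?thesis .
  next
    case False
    then have "b = 1" using a t by (simp add: b_def max_def divide_simps)
    then show ?thesis using False t that by (simp add: pareto_orlicz_def right_diff_distrib)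
  qed
  then have "has_bochner_integral N (\<lambda>\<omega>. indicator {b..} (X \<omega>) * (a * X \<omega> - t)) (t * pareto_orlicz p (a / t))"
    using pareto_partial_mean[OF p D, of b a t] by (simp add: b_def)
  also have "?this \<longleftrightarrow> ?thesis"
  proof (intro has_bochner_integral_cong_AE)
    show "AE \<omega> in N. indicator {b..} (X \<omega>) * (a * X \<omega> - t) = max 0 (\<bar>a * X \<omega>\<bar> - t)"
      using pareto_AE_ge_1[OF p N D]
    proof eventually_elim
      case (elim \<omega>)
      then have "a * X \<omega> > 0" "X \<omega> \<ge> b \<longleftrightarrow> a * X \<omega> \<ge> t"
        using a by (auto simp: b_def divide_simps mult.commute)
      then show ?case by (auto simp: indicator_def max_def)
    qed
  qed auto
  finally show ?thesis .
qed

lemma pareto_integrable: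
  assumes p: "p > 1" and N: "prob_space N" and D: "distributed N lborel X (log_gamma_density 1 p)"
  shows "integrable N X"
proof -
  interpret prob_space N by fact
  have [measurable]: "X \<in> borel_measurable N" using distributed_measurable[OF D] by simp
  have "integrable N (\<lambda>\<omega>. max 0 (\<bar>1 * X \<omega>\<bar> - 1) + 1)"
    using pareto_excess[OF p N D, of 1 1] by (simp add: has_bochner_integral_iff)
  then show ?thesis by (rule Bochner_Integration.integrable_bound) auto
qed

text \<open>The integrand in the definition of the Orlicz function is its derivative; inserting the tail
  it collapses to the single expression \<open>p / (p - 1) * min 1 t powr (p - 1)\<close>.\<close>

lemma orlicz_fun_of_pareto:
  assumes p: "p > 1" and N: "prob_space N" and D: "distributed N lborel X (log_gamma_density 1 p)"
    and s: "s \<ge> 0"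
  shows "orlicz_fun_of N X s = pareto_orlicz p s"
proof -
  let ?P = "\<lambda>u. if u \<le> 1 then 1 else u powr (- p) :: real"
  have inner: "1 / t * ?P (1 / t) + (LBINT u:{1 / t..}. ?P u) = p / (p - 1) * min 1 t powr (p - 1)"
    if t: "t > 0" for t
  proof (cases "t \<le> 1")
    case True
    have "has_bochner_integral lborel (\<lambda>u. indicator {1/t..} u * u powr (- p))
            ((1/t) powr (- p + 1) / (- (- p) - 1))"
      using t p by (intro has_bochner_integral_powr_tail) auto
    moreover have "(\<lambda>u. indicator {1/t..} u * u powr (- p)) = (\<lambda>u. indicator {1/t..} u * ?P u)"
    proof
      fix u show "indicator {1/t..} u * u powr (- p) = indicator {1/t..} u * ?P u"
      proof (cases "u \<ge> 1 / t")
        case True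
        moreover have "1 / t \<ge> 1" using \<open>t \<le> 1\<close> t by simp
        ultimately have "u \<ge> 1" by linarith
        then show ?thesis by (cases "u = 1") auto
      qed auto
    qed
    ultimately have I: "(LBINT u:{1 / t..}. ?P u) = (1/t) powr (- p + 1) / (p - 1)"
      by (simp add: set_lebesgue_integral_def has_bochner_integral_iff)
    have e1: "(1/t) powr (- p + 1) = t powr (p - 1)"
      using t by (simp add: powr_divide powr_minus_divide[symmetric])
    have "1 / t * ?P (1 / t) = 1 / t * (1 / t) powr (- p)" using True t by (cases "t = 1") auto
    also have "\<dots> = (1 / t) powr 1 * (1 / t) powr (- p)" using t by simp
    also have "\<dots> = t powr (p - 1)" unfolding e1[symmetric] by (subst powr_add[symmetric]) (simp add: add.commute)
    finally show ?thesis unfolding I e1 using True p by (simp add: field_simps)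
  next
    case False
    have "has_bochner_integral lborel (\<lambda>u. indicator {1/t..<1} u * 1 + indicator {1..} u * u powr (- p))
            (1 - 1/t + 1 powr (- p + 1) / (- (- p) - 1))"
    proof (intro has_bochner_integral_add has_bochner_integral_powr_tail)
      show "has_bochner_integral lborel (\<lambda>u. indicator {1/t..<1} u * 1 :: real) (1 - 1/t)"
        using has_bochner_integral_real_indicator[of "{1/t..<1}" lborel] False by simp
    qed (use p in auto)
    moreover have "(\<lambda>u. indicator {1/t..<1} u * 1 + indicator {1..} u * u powr (- p))
        = (\<lambda>u. indicator {1/t..} u * ?P u)"
    proof
      fix u have "1 / t < 1" using False by simp
      then show "indicator {1/t..<1} u * 1 + indicator {1..} u * u powr (- p) = indicator {1/t..} u * ?P u"
        by (cases "u = 1") (auto simp: indicator_def)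
    qed
    ultimately have I: "(LBINT u:{1 / t..}. ?P u) = 1 - 1/t + 1 / (p - 1)"
      by (simp add: set_lebesgue_integral_def has_bochner_integral_iff)
    show ?thesis unfolding I using False t p by (simp add: field_simps)
  qed
  have "orlicz_fun_of N X s = (LBINT t:{0<..s}. p / (p - 1) * min 1 t powr (p - 1))"
    unfolding orlicz_fun_of_def pareto_tail[OF p N D]
    by (intro set_lebesgue_integral_cong) (use inner in auto)
  also have "\<dots> = pareto_orlicz p s"
  proof -
    \<comment> \<open>The integrand is a power up to \<open>m\<close> and constant on the rest \<open>{m<..s}\<close>, which is empty for
      \<open>s \<le> 1\<close>.\<close>
    define m where "m = min 1 s"
    have "has_bochner_integral lborel (\<lambda>t. indicator {0..m} t * t powr (p - 1)) (m powr (p - 1 + 1) / (p - 1 + 1))"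
      using p s by (intro has_bochner_integral_lborel_of_has_integral has_integral_powr_from_0) (auto simp: m_def)
    moreover have "has_bochner_integral lborel (indicator {m<..s} :: real \<Rightarrow> real) (s - m)"
      using has_bochner_integral_real_indicator[of "{m<..s}" lborel] by (simp add: m_def)
    ultimately have "has_bochner_integral lborel
        (\<lambda>t. p / (p - 1) * (indicator {0..m} t * t powr (p - 1) + indicator {m<..s} t))
        (p / (p - 1) * (m powr (p - 1 + 1) / (p - 1 + 1) + (s - m)))"
      by (intro has_bochner_integral_mult_right has_bochner_integral_add)
    moreover have "(\<lambda>t. p / (p - 1) * (indicator {0..m} t * t powr (p - 1) + indicator {m<..s} t))
      = (\<lambda>t. indicator {0<..s} t * (p / (p - 1) * min 1 t powr (p - 1)))"
    proof
      fix t :: real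
      consider "t < 0" | "t = 0" | "0 < t" "t \<le> m" | "m < t" "t \<le> s" "t > 0" | "t > s" "t > 0" by linarith
      then show "p / (p - 1) * (indicator {0..m} t * t powr (p - 1) + indicator {m<..s} t)
         = indicator {0<..s} t * (p / (p - 1) * min 1 t powr (p - 1))"
        by cases (use s in \<open>auto simp: m_def indicator_def min_def split: if_splits\<close>)
    qed
    ultimately have "has_bochner_integral lborel
        (\<lambda>t. indicator {0<..s} t * (p / (p - 1) * min 1 t powr (p - 1)))
        (p / (p - 1) * (m powr (p - 1 + 1) / (p - 1 + 1) + (s - m)))"
      by (simp only:)
    then have "(LBINT t:{0<..s}. p / (p - 1) * min 1 t powr (p - 1))
        = p / (p - 1) * (m powr (p - 1 + 1) / (p - 1 + 1) + (s - m))"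
      unfolding set_lebesgue_integral_def real_scaleR_def by (rule has_bochner_integral_integral_eq)
    also have "\<dots> = p / (p - 1) * (m powr p / p + (s - m))" by simp
    also have "\<dots> = pareto_orlicz p s"
      using p by (auto simp: m_def pareto_orlicz_def min_def field_simps)
    finally show ?thesis .
  qed
  finally show ?thesis .
qed

section \<open>Maxima of independent random variables\<close>

lemma (in prob_space) integrable_Max:
  fixes Y :: "'i \<Rightarrow> 'a \<Rightarrow> real"
  assumes "finite I" "I \<noteq> {}" "\<And>i. i \<in> I \<Longrightarrow> integrable M (Y i)"
  shows "integrable M (\<lambda>\<omega>. Max ((\<lambda>i. Y i \<omega>) ` I))"
  using assms
proof (induction I rule: finite_ne_induct)
  case (insert i I)
  have "(\<lambda>\<omega>. Max ((\<lambda>i. Y i \<omega>) ` insert i I)) = (\<lambda>\<omega>. max (Y i \<omega>) (Max ((\<lambda>i. Y i \<omega>) ` I)))"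
    using insert by (auto simp: fun_eq_iff)
  then show ?case using insert by (simp add: integrable_max)
qed simp

lemma (in prob_space) expectation_Max_le:
  fixes Y :: "'i \<Rightarrow> 'a \<Rightarrow> real"
  assumes I: "finite I" "I \<noteq> {}" and Y: "\<And>i. i \<in> I \<Longrightarrow> integrable M (Y i)"
  shows "expectation (\<lambda>\<omega>. Max ((\<lambda>i. Y i \<omega>) ` I)) \<le> t + (\<Sum>i\<in>I. expectation (\<lambda>\<omega>. max 0 (Y i \<omega> - t)))"
proof -
  have "expectation (\<lambda>\<omega>. Max ((\<lambda>i. Y i \<omega>) ` I)) \<le> expectation (\<lambda>\<omega>. t + (\<Sum>i\<in>I. max 0 (Y i \<omega> - t)))"
  proof (rule integral_mono)
    fix \<omega>
    show "Max ((\<lambda>i. Y i \<omega>) ` I) \<le> t + (\<Sum>i\<in>I. max 0 (Y i \<omega> - t))"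
    proof (rule Max.boundedI)
      fix y assume "y \<in> (\<lambda>i. Y i \<omega>) ` I"
      then obtain i where i: "i \<in> I" "y = Y i \<omega>" by auto
      have "max 0 (Y i \<omega> - t) \<le> (\<Sum>i\<in>I. max 0 (Y i \<omega> - t))"
        by (rule member_le_sum) (use i I in auto)
      with i show "y \<le> t + (\<Sum>i\<in>I. max 0 (Y i \<omega> - t))" by linarith
    qed (use I in auto)
  qed (use I Y in \<open>auto intro!: integrable_Max integrable_max Bochner_Integration.integrable_add Bochner_Integration.integrable_sum\<close>)
  also have "\<dots> = t + (\<Sum>i\<in>I. expectation (\<lambda>\<omega>. max 0 (Y i \<omega> - t)))"
    using Y by (subst Bochner_Integration.integral_add)
      (auto intro!: integrable_max Bochner_Integration.integrable_sum Bochner_Integration.integral_sum simp: prob_space)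
  finally show ?thesis .
qed

text \<open>The \<open>i\<close>-th summand is the excess of \<open>y i\<close> over \<open>t\<close>, counted only if all other entries stay
  below \<open>t\<close>. It vanishes unless \<open>i\<close> is a position of the maximum, so the sum reduces to a single
  term. It is written as one product over \<open>I\<close> with factors depending on one entry each, the form
  to which independence applies.\<close>

lemma Max_ge_excess:
  fixes y :: "'i \<Rightarrow> real"
  assumes I: "finite I" "I \<noteq> {}" and y: "\<And>i. i \<in> I \<Longrightarrow> y i \<ge> 0"
  shows "t * (1 - (\<Prod>j\<in>I. indicator {..<t} (y j))) +
      (\<Sum>i\<in>I. \<Prod>j\<in>I. if j = i then max 0 (y j - t) else indicator {..<t} (y j)) \<le> Max (y ` I)"
proof -
  obtain k where k: "k \<in> I" "y k = Max (y ` I)"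
  proof -
    have "Max (y ` I) \<in> y ` I" using I by (intro Max_in) auto
    then show ?thesis using that by force
  qed
  have le: "y i \<le> y k" if "i \<in> I" for i using k that I by simp
  let ?h = "\<lambda>i j. if j = i then max 0 (y j - t) else indicator {..<t} (y j) :: real"
  have off: "(\<Prod>j\<in>I. ?h i j) = 0" if i: "i \<in> I" "i \<noteq> k" for i
  proof (cases "y k < t")
    case True
    then have "?h i i = 0" using le[OF i(1)] by simp
    then show ?thesis using i I by (intro prod_zero) blast+
  next
    case False
    then have "?h i k = 0" using i by simp
    then show ?thesis using k I by (intro prod_zero) blast+
  qed
  have "(\<Sum>i\<in>I. \<Prod>j\<in>I. ?h i j) = (\<Sum>i\<in>{k}. \<Prod>j\<in>I. ?h i j)"
    using I k off by (intro sum.mono_neutral_right) auto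
  also have "\<dots> = max 0 (y k - t) * (\<Prod>j\<in>I-{k}. ?h k j)"
    using I k by (simp add: prod.remove)
  also have "\<dots> \<le> max 0 (y k - t) * 1"
    by (intro mult_left_mono prod_le_1) (auto simp: indicator_def)
  finally have S: "(\<Sum>i\<in>I. \<Prod>j\<in>I. ?h i j) \<le> max 0 (y k - t)" by simp
  show ?thesis
  proof (cases "y k < t")
    case True
    then have "(\<Prod>j\<in>I. indicator {..<t} (y j)) = (1::real)"
      using le by (intro prod.neutral) (fastforce simp: indicator_def)
    with S True y[OF k(1)] k show ?thesis by simp
  next
    case False
    then have "indicator {..<t} (y k) = (0::real)" by simp
    then have "(\<Prod>j\<in>I. indicator {..<t} (y j)) = (0::real)"
      using I k(1) by (intro prod_zero) blast+
    with S False k show ?thesis by simp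
  qed
qed

text \<open>With \<open>Q\<close> the probability that all \<open>Y i\<close> stay below \<open>t\<close>, independence turns the pointwise
  bound above into \<open>t (1 - Q) + S Q\<close> with \<open>S\<close> the total mean excess, and \<open>S \<ge> t\<close> removes \<open>Q\<close>.\<close>

lemma (in prob_space) expectation_Max_ge:
  fixes Y :: "'i \<Rightarrow> 'a \<Rightarrow> real"
  assumes I: "finite I" "I \<noteq> {}" and ind: "indep_vars (\<lambda>_. borel) Y I"
    and Y: "\<And>i. i \<in> I \<Longrightarrow> integrable M (Y i)" and nonneg: "\<And>i \<omega>. i \<in> I \<Longrightarrow> Y i \<omega> \<ge> 0"
    and t: "t \<le> (\<Sum>i\<in>I. expectation (\<lambda>\<omega>. max 0 (Y i \<omega> - t)))"
  shows "t \<le> expectation (\<lambda>\<omega>. Max ((\<lambda>i. Y i \<omega>) ` I))"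
proof -
  let ?h = "\<lambda>i j y. if j = i then max 0 (y - t) else indicator {..<t} y :: real"
  let ?e = "\<lambda>i. expectation (\<lambda>\<omega>. max 0 (Y i \<omega> - t))"
  define q where "q j = expectation (\<lambda>\<omega>. indicator {..<t} (Y j \<omega>) :: real)" for j
  define Q where "Q = (\<Prod>j\<in>I. q j)"
  have [measurable]: "Y i \<in> borel_measurable M" if "i \<in> I" for i using Y[OF that] by simp
  have int: "integrable M (\<lambda>\<omega>. ?h i j (Y j \<omega>))" if "j \<in> I" for i j
    using that Y[OF that] by (cases "j = i") (auto intro!: integrable_const_bound[where B=1])
  have int1: "integrable M (\<lambda>\<omega>. indicator {..<t} (Y j \<omega>) :: real)" if "j \<in> I" for j
    using that by (auto intro!: integrable_const_bound[where B=1])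
  have ind1: "indep_vars (\<lambda>_. borel) (\<lambda>j \<omega>. indicator {..<t} (Y j \<omega>) :: real) I"
    by (rule indep_vars_compose2[OF ind]) simp
  have indh: "indep_vars (\<lambda>_. borel) (\<lambda>j \<omega>. ?h i j (Y j \<omega>)) I" for i
    by (rule indep_vars_compose2[OF ind]) simp
  have q01: "0 \<le> q j" "q j \<le> 1" if "j \<in> I" for j
  proof -
    show "0 \<le> q j" unfolding q_def by simp
    have "q j \<le> expectation (\<lambda>_. 1)" unfolding q_def
      by (intro integral_mono int1 that) (auto simp: indicator_def)
    then show "q j \<le> 1" by (simp add: prob_space)
  qed
  have Q01: "0 \<le> Q" "Q \<le> 1" unfolding Q_def using q01 by (auto intro: prod_nonneg prod_le_1)
  have Pint1: "integrable M (\<lambda>\<omega>. \<Prod>j\<in>I. indicator {..<t} (Y j \<omega>) :: real)"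
    by (rule indep_vars_integrable[OF I(1) ind1 int1])
  have Pinth: "integrable M (\<lambda>\<omega>. \<Prod>j\<in>I. ?h i j (Y j \<omega>))" for i
    by (rule indep_vars_integrable[OF I(1) indh int])
  have E1: "expectation (\<lambda>\<omega>. \<Prod>j\<in>I. indicator {..<t} (Y j \<omega>) :: real) = Q"
    unfolding Q_def q_def by (rule indep_vars_lebesgue_integral[OF I(1) ind1 int1])
  have Eh: "expectation (\<lambda>\<omega>. \<Prod>j\<in>I. ?h i j (Y j \<omega>)) \<ge> ?e i * Q" if i: "i \<in> I" for i
  proof -
    have "expectation (\<lambda>\<omega>. \<Prod>j\<in>I. ?h i j (Y j \<omega>)) = (\<Prod>j\<in>I. expectation (\<lambda>\<omega>. ?h i j (Y j \<omega>)))"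
      by (rule indep_vars_lebesgue_integral[OF I(1) indh int])
    also have "\<dots> = ?e i * (\<Prod>j\<in>I-{i}. q j)"
      using I i by (subst prod.remove[of I i]) (auto simp: q_def intro!: prod.cong)
    also have "\<dots> \<ge> ?e i * Q"
    proof (rule mult_left_mono)
      have "Q = q i * (\<Prod>j\<in>I-{i}. q j)" unfolding Q_def using I i by (simp add: prod.remove)
      also have "\<dots> \<le> 1 * (\<Prod>j\<in>I-{i}. q j)"
        using q01 i by (intro mult_right_mono prod_nonneg) auto
      finally show "Q \<le> (\<Prod>j\<in>I-{i}. q j)" by simp
    qed simp
    finally show ?thesis .
  qed
  have "t = t * (1 - Q) + t * Q" by (simp add: algebra_simps)
  also have "\<dots> \<le> t * (1 - Q) + (\<Sum>i\<in>I. ?e i) * Q"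
    using t Q01 by (intro add_left_mono mult_right_mono)
  also have "\<dots> \<le> t * (1 - Q) + (\<Sum>i\<in>I. expectation (\<lambda>\<omega>. \<Prod>j\<in>I. ?h i j (Y j \<omega>)))"
    unfolding sum_distrib_right by (intro add_left_mono sum_mono Eh)
  also have "\<dots> = expectation (\<lambda>\<omega>. t * (1 - (\<Prod>j\<in>I. indicator {..<t} (Y j \<omega>))) + (\<Sum>i\<in>I. \<Prod>j\<in>I. ?h i j (Y j \<omega>)))"
    using Pint1 Pinth by (simp add: E1 prob_space del: if_distrib)
  also have "\<dots> \<le> expectation (\<lambda>\<omega>. Max ((\<lambda>i. Y i \<omega>) ` I))"
  proof (rule integral_mono)
    show "t * (1 - (\<Prod>j\<in>I. indicator {..<t} (Y j \<omega>))) + (\<Sum>i\<in>I. \<Prod>j\<in>I. ?h i j (Y j \<omega>)) \<le> Max ((\<lambda>i. Y i \<omega>) ` I)" for \<omega>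
      using Max_ge_excess[OF I, of "\<lambda>i. Y i \<omega>" t] nonneg by simp
    show "integrable M (\<lambda>\<omega>. t * (1 - (\<Prod>j\<in>I. indicator {..<t} (Y j \<omega>))) + (\<Sum>i\<in>I. \<Prod>j\<in>I. ?h i j (Y j \<omega>)))"
      using Pint1 Pinth
      by (intro Bochner_Integration.integrable_add Bochner_Integration.integrable_sum integrable_mult_right
          Bochner_Integration.integrable_diff) auto
  qed (use integrable_Max I Y in auto)
  finally show ?thesis .
qed

section \<open>The two-sided estimate\<close>

text \<open>The infimum in the Orlicz norm has to run over a nonempty set: an infimum of the empty set of
  reals would say nothing about the upper estimate.\<close>

lemma orlicz_norm_witness:
  fixes x :: "nat \<Rightarrow> real"
  assumes p: "p > 1"
  shows "\<exists>t>0. (\<Sum>i = 1..n. pareto_orlicz p (\<bar>x i\<bar> / t)) \<le> 1"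
proof -
  define S where "S = (\<Sum>i = 1..n. \<bar>x i\<bar>)"
  \<comment> \<open>The first summand makes all arguments at most \<open>1\<close>, where \<open>s powr p \<le> s\<close>; the second one then
    bounds the sum; the third one keeps \<open>t\<close> positive when \<open>x\<close> vanishes.\<close>
  define t where "t = S + S / (p - 1) + 1"
  have S: "S \<ge> 0" unfolding S_def by (simp add: sum_nonneg)
  then have Sp: "S / (p - 1) \<ge> 0" using p by simp
  have t: "t > 0" "t \<ge> S" "t \<ge> S / (p - 1)" using S Sp by (auto simp: t_def)
  have "pareto_orlicz p (\<bar>x i\<bar> / t) \<le> 1 / (p - 1) * (\<bar>x i\<bar> / t)" if i: "i \<in> {1..n}" for i
  proof -
    have "\<bar>x i\<bar> \<le> S" unfolding S_def by (rule member_le_sum) (use i in auto)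
    then have s: "\<bar>x i\<bar> / t \<le> 1" "\<bar>x i\<bar> / t \<ge> 0" using t by auto
    have "u powr p \<le> u powr 1" if "0 \<le> u" "u \<le> 1" for u :: real
      using powr_mono'[of 1 p u] p that by simp
    from this[OF s(2,1)] have "(\<bar>x i\<bar> / t) powr p \<le> \<bar>x i\<bar> / t" using s by simp
    then have "1 / (p - 1) * (\<bar>x i\<bar> / t) powr p \<le> 1 / (p - 1) * (\<bar>x i\<bar> / t)"
      using p by (intro mult_left_mono) auto
    then show ?thesis using s(1) by (simp only: pareto_orlicz_def if_True)
  qed
  then have "(\<Sum>i = 1..n. pareto_orlicz p (\<bar>x i\<bar> / t)) \<le> (\<Sum>i = 1..n. 1 / (p - 1) * (\<bar>x i\<bar> / t))"
    by (rule sum_mono)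
  also have "\<dots> = S / (p - 1) / t"
    by (simp add: S_def sum_divide_distrib)
  also have "\<dots> \<le> 1" using t by (simp only: divide_le_eq_1_pos)
  finally show ?thesis using t by blast
qed

lemma distributed_of_distr_eq:
  assumes "distributed N lborel X f" "distr M borel Y = distr N borel X" "Y \<in> borel_measurable M"
  shows "distributed M lborel Y f"
proof -
  have "distr M lborel Y = distr M borel Y" "distr N lborel X = distr N borel X"
    by (auto intro!: distr_cong)
  with assms show ?thesis by (auto simp: distributed_def)
qed

text \<open>A level \<open>t\<close> is admissible in the norm iff the total mean excess over \<open>t\<close> is at most \<open>t\<close>.
  Admissible levels bound the expected maximum by \<open>2 * t\<close>, the others are at most the expected
  maximum; hence every level above the expected maximum is admissible.\<close>

lemma max_comparison_1_2: "max_comparison TYPE('a) 1 2"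
  unfolding max_comparison_def
proof (intro allI impI)
  fix p :: real and n :: nat and N M :: "'a measure" and X \<xi> and x :: "nat \<Rightarrow> real"
  assume p: "p > 1" and n: "n \<ge> 1" and N: "prob_space N"
    and D: "distributed N lborel X (log_gamma_density 1 p)"
    and M: "prob_space M" and iid: "iid_copies M n \<xi> N X"
  interpret prob_space M by fact
  have ind: "indep_vars (\<lambda>_. borel) \<xi> {1..n}"
    and dist: "\<And>i. i \<in> {1..n} \<Longrightarrow> distr M borel (\<xi> i) = distr N borel X"
    using iid by (auto simp: iid_copies_def)
  have rv [measurable]: "\<xi> i \<in> borel_measurable M" if "i \<in> {1..n}" for i
    using ind that by (auto simp: indep_vars_def)
  have Di: "distributed M lborel (\<xi> i) (log_gamma_density 1 p)" if "i \<in> {1..n}" for i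
    using distributed_of_distr_eq[OF D dist rv] that by blast
  let ?Y = "\<lambda>i \<omega>. \<bar>x i * \<xi> i \<omega>\<bar>"
  let ?E = "expectation (\<lambda>\<omega>. Max ((\<lambda>i. ?Y i \<omega>) ` {1..n}))"
  let ?\<Phi> = "\<lambda>t. \<Sum>i = 1..n. pareto_orlicz p (\<bar>x i\<bar> / t)"
  have I: "finite {1..n}" "{1..n} \<noteq> {}" using n by auto
  have intY: "integrable M (?Y i)" if "i \<in> {1..n}" for i
    using pareto_integrable[OF p M Di[OF that]] by simp
  have indY: "indep_vars (\<lambda>_. borel) ?Y {1..n}"
    by (rule indep_vars_compose2[OF ind]) simp
  have exc: "(\<Sum>i = 1..n. expectation (\<lambda>\<omega>. max 0 (?Y i \<omega> - t))) = t * ?\<Phi> t" if t: "t > 0" for t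
    unfolding sum_distrib_left
  proof (rule sum.cong)
    fix i assume "i \<in> {1..n}"
    from pareto_excess[OF p M Di[OF this] t, of "\<bar>x i\<bar>"]
    show "expectation (\<lambda>\<omega>. max 0 (?Y i \<omega> - t)) = t * pareto_orlicz p (\<bar>x i\<bar> / t)"
      by (simp add: has_bochner_integral_iff abs_mult)
  qed simp
  have upper: "?E \<le> 2 * t" if t: "t > 0" "?\<Phi> t \<le> 1" for t
  proof -
    have "?E \<le> t + t * ?\<Phi> t"
      using expectation_Max_le[where Y = ?Y and t = t, OF I intY] by (simp only: exc[OF t(1)])
    also have "\<dots> \<le> t + t * 1" using t by (intro add_left_mono mult_left_mono) auto
    finally show ?thesis by simp
  qed
  have lower: "t \<le> ?E" if t: "t > 0" "?\<Phi> t > 1" for t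
  proof -
    have "t * 1 \<le> t * ?\<Phi> t" using t by (intro mult_left_mono) auto
    then show ?thesis
      by (intro expectation_Max_ge[OF I indY intY]) (use exc[OF t(1)] in auto)
  qed
  let ?T = "{t. t > 0 \<and> ?\<Phi> t \<le> 1}"
  have norm: "orlicz_norm (orlicz_fun_of N X) n x = Inf ?T"
    unfolding orlicz_norm_def
    by (intro arg_cong[where f=Inf] Collect_cong conj_cong refl arg_cong2[where f="(\<le>)"] sum.cong
        orlicz_fun_of_pareto[OF p N D]) auto
  have bdd: "bdd_below ?T" by (rule bdd_belowI[of _ 0]) auto
  have ne: "?T \<noteq> {}" using orlicz_norm_witness[OF p, where x = x and n = n] by auto
  have "?E / 2 \<le> Inf ?T" using ne upper by (intro cInf_greatest) fastforce+
  moreover have "Inf ?T \<le> ?E"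
  proof (rule dense_ge)
    have "?E \<ge> 0" using I by (intro integral_nonneg_AE AE_I2) (auto simp: Max_ge_iff)
    fix t assume t: "?E < t"
    then have "t > 0" "?\<Phi> t \<le> 1" using \<open>?E \<ge> 0\<close> lower[of t] by force+
    then show "Inf ?T \<le> t" using bdd by (intro cInf_lower) auto
  qed
  ultimately show "1 * orlicz_norm (orlicz_fun_of N X) n x \<le> ?E \<and> ?E \<le> 2 * orlicz_norm (orlicz_fun_of N X) n x"
    unfolding norm by simp
qed

section \<open>Independence of the sample space\<close>

lemma orlicz_fun_of_cong_distr:
  assumes [measurable]: "X \<in> borel_measurable N" "Y \<in> borel_measurable M"
    and eq: "distr N borel X = distr M borel Y"
  shows "orlicz_fun_of N X = orlicz_fun_of M Y"
proof -
  have "measure N {\<omega> \<in> space N. \<bar>X \<omega>\<bar> \<ge> u} = measure (distr N borel X) {y. \<bar>y\<bar> \<ge> u}" for u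
    by (subst measure_distr) (auto intro!: arg_cong2[where f=measure])
  moreover have "measure M {\<omega> \<in> space M. \<bar>Y \<omega>\<bar> \<ge> u} = measure (distr M borel Y) {y. \<bar>y\<bar> \<ge> u}" for u
    by (subst measure_distr) (auto intro!: arg_cong2[where f=measure])
  ultimately show ?thesis using eq by (simp add: orlicz_fun_of_def fun_eq_iff)
qed

text \<open>Given copies on a space over \<open>'a\<close>, the coordinates on the product \<open>P\<close> of \<open>n\<close> copies of the
  distribution of \<open>X\<close> form another realisation with the same joint distribution, now over
  \<open>nat \<Rightarrow> real\<close>. The first coordinate replaces \<open>X\<close>; it exists because \<open>n \<ge> 1\<close>.\<close>

lemma max_comparison_transfer:
  assumes "max_comparison TYPE(nat \<Rightarrow> real) c C"
  shows "max_comparison TYPE('a) c C"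
  unfolding max_comparison_def
proof (intro allI impI)
  fix p :: real and n :: nat and N M :: "'a measure" and X \<xi> and x :: "nat \<Rightarrow> real"
  assume p: "p > 1" and n: "n \<ge> 1" and N: "prob_space N"
    and D: "distributed N lborel X (log_gamma_density 1 p)"
    and M: "prob_space M" and iid: "iid_copies M n \<xi> N X"
  interpret prob_space M by fact
  have ind: "indep_vars (\<lambda>_. borel) \<xi> {1..n}"
    and dist: "\<And>i. i \<in> {1..n} \<Longrightarrow> distr M borel (\<xi> i) = distr N borel X"
    using iid by (auto simp: iid_copies_def)
  have rv [measurable]: "\<xi> i \<in> borel_measurable M" if "i \<in> {1..n}" for i
    using ind that by (auto simp: indep_vars_def)
  have [measurable]: "X \<in> borel_measurable N" using distributed_measurable[OF D] by simp
  define \<mu> where "\<mu> = distr N borel X"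
  interpret mu: prob_space \<mu> unfolding \<mu>_def by (rule prob_space.prob_space_distr[OF N]) simp
  define P where "P = (\<Pi>\<^sub>M i\<in>{1..n}. \<mu>)"
  interpret P: prob_space P unfolding P_def by (rule prob_space_PiM) unfold_locales
  have sets_P: "sets P = sets (\<Pi>\<^sub>M i\<in>{1..n}. borel)"
    unfolding P_def by (intro sets_PiM_cong) (auto simp: \<mu>_def)
  have P: "P = distr M (\<Pi>\<^sub>M i\<in>{1..n}. borel) (\<lambda>\<omega>. \<lambda>i\<in>{1..n}. \<xi> i \<omega>)"
  proof -
    have "distr M (\<Pi>\<^sub>M i\<in>{1..n}. borel) (\<lambda>\<omega>. \<lambda>i\<in>{1..n}. \<xi> i \<omega>) = (\<Pi>\<^sub>M i\<in>{1..n}. distr M borel (\<xi> i))"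
      using ind rv n by (subst (asm) indep_vars_iff_distr_eq_PiM') auto
    also have "\<dots> = P" unfolding P_def by (intro PiM_cong) (auto simp: dist \<mu>_def)
    finally show ?thesis by simp
  qed
  have coord: "(\<lambda>\<omega>. \<omega> i) \<in> borel_measurable P" if "i \<in> {1..n}" for i
    unfolding measurable_cong_sets[OF sets_P refl] using that by measurable
  have dP: "distr P borel (\<lambda>\<omega>. \<omega> i) = distr N borel X" if i: "i \<in> {1..n}" for i
  proof -
    have "distr P \<mu> (\<lambda>\<omega>. \<omega> i) = \<mu>" unfolding P_def
      by (rule distr_PiM_component) (use i mu.prob_space_axioms in auto)
    moreover have "distr P borel (\<lambda>\<omega>. \<omega> i) = distr P \<mu> (\<lambda>\<omega>. \<omega> i)"
      by (rule distr_cong) (auto simp: \<mu>_def)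
    ultimately show ?thesis by (simp add: \<mu>_def)
  qed
  have one: "1 \<in> {1..n}" using n by simp
  have "distributed P lborel (\<lambda>\<omega>. \<omega> 1) (log_gamma_density 1 p)"
    by (rule distributed_of_distr_eq[OF D dP[OF one] coord[OF one]])
  moreover have "iid_copies P n (\<lambda>i \<omega>. \<omega> i) P (\<lambda>\<omega>. \<omega> 1)"
    unfolding iid_copies_def
  proof
    show "P.indep_vars (\<lambda>_. borel) (\<lambda>i \<omega>. \<omega> i) {1..n}"
    proof (subst P.indep_vars_iff_distr_eq_PiM')
      have "distr P (\<Pi>\<^sub>M i\<in>{1..n}. borel) (\<lambda>\<omega>. \<lambda>i\<in>{1..n}. \<omega> i) = distr P P (\<lambda>\<omega>. \<omega>)"
        by (rule distr_cong) (simp_all only: sets_P, simp_all add: P_def space_PiM PiE_restrict)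
      also have "\<dots> = P" by (rule distr_id)
      also have "\<dots> = (\<Pi>\<^sub>M i\<in>{1..n}. distr P borel (\<lambda>\<omega>. \<omega> i))"
        by (subst P_def, intro PiM_cong) (auto simp: dP \<mu>_def)
      finally show "distr P (\<Pi>\<^sub>M i\<in>{1..n}. borel) (\<lambda>\<omega>. \<lambda>i\<in>{1..n}. \<omega> i)
          = (\<Pi>\<^sub>M i\<in>{1..n}. distr P borel (\<lambda>\<omega>. \<omega> i))" .
    qed (use n coord in auto)
  qed (use dP one in auto)
  ultimately have
    "c * orlicz_norm (orlicz_fun_of P (\<lambda>\<omega>. \<omega> 1)) n x \<le> P.expectation (\<lambda>\<omega>. Max ((\<lambda>i. \<bar>x i * \<omega> i\<bar>) ` {1..n}))
     \<and> P.expectation (\<lambda>\<omega>. Max ((\<lambda>i. \<bar>x i * \<omega> i\<bar>) ` {1..n})) \<le> C * orlicz_norm (orlicz_fun_of P (\<lambda>\<omega>. \<omega> 1)) n x"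
    using assms[unfolded max_comparison_def] p n P.prob_space_axioms by blast
  moreover have "orlicz_fun_of P (\<lambda>\<omega>. \<omega> 1) = orlicz_fun_of N X"
    by (rule orlicz_fun_of_cong_distr) (use coord[OF one] dP[OF one] in auto)
  moreover have "P.expectation (\<lambda>\<omega>. Max ((\<lambda>i. \<bar>x i * \<omega> i\<bar>) ` {1..n}))
      = expectation (\<lambda>\<omega>. Max ((\<lambda>i. \<bar>x i * \<xi> i \<omega>\<bar>) ` {1..n}))"
  proof -
    have "P.expectation (\<lambda>\<omega>. Max ((\<lambda>i. \<bar>x i * \<omega> i\<bar>) ` {1..n}))
      = expectation (\<lambda>\<omega>. Max ((\<lambda>i. \<bar>x i * (\<lambda>i\<in>{1..n}. \<xi> i \<omega>) i\<bar>) ` {1..n}))"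
      unfolding P by (rule integral_distr) measurable
    also have "\<dots> = expectation (\<lambda>\<omega>. Max ((\<lambda>i. \<bar>x i * \<xi> i \<omega>\<bar>) ` {1..n}))"
      by (intro Bochner_Integration.integral_cong refl arg_cong[where f=Max] image_cong) auto
    finally show ?thesis .
  qed
  ultimately show "c * orlicz_norm (orlicz_fun_of N X) n x \<le> expectation (\<lambda>\<omega>. Max ((\<lambda>i. \<bar>x i * \<xi> i \<omega>\<bar>) ` {1..n}))
     \<and> expectation (\<lambda>\<omega>. Max ((\<lambda>i. \<bar>x i * \<xi> i \<omega>\<bar>) ` {1..n})) \<le> C * orlicz_norm (orlicz_fun_of N X) n x"
    by simp
qed

theorem theorem3p1:
  shows "(\<exists>c>0. \<exists>C>0. max_comparison TYPE(nat \<Rightarrow> real) c C)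
    \<and> (\<forall>c>0. \<forall>C>0. max_comparison TYPE(nat \<Rightarrow> real) c C \<longrightarrow> max_comparison TYPE('a) c C)
    \<and> (\<forall>(p::real) (N::'a measure) X (s::real).
         p > 1 \<longrightarrow> prob_space N \<longrightarrow> distributed N lborel X (log_gamma_density 1 p) \<longrightarrow> s \<ge> 0 \<longrightarrow>
         orlicz_fun_of N X s =
           (if s \<le> 1 then 1 / (p - 1) * s powr p else p / (p - 1) * s - 1))"
proof (intro conjI allI impI)
  show "\<exists>c>0. \<exists>C>0. max_comparison TYPE(nat \<Rightarrow> real) c C"
    using max_comparison_1_2 zero_less_one zero_less_numeral by blast
next
  fix c C :: real
  assume "max_comparison TYPE(nat \<Rightarrow> real) c C"
  then show "max_comparison TYPE('a) c C" by (rule max_comparison_transfer)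
next
  fix p :: real and N :: "'a measure" and X :: "'a \<Rightarrow> real" and s :: real
  assume "p > 1" "prob_space N" "distributed N lborel X (log_gamma_density 1 p)" "s \<ge> 0"
  then show "orlicz_fun_of N X s =
      (if s \<le> 1 then 1 / (p - 1) * s powr p else p / (p - 1) * s - 1)"
    by (simp add: orlicz_fun_of_pareto pareto_orlicz_def)
qed

end
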